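(* Let $(P,\ell,\mathcal F)$ be a learning problem with optimal $f^*$ and let $\Pi_|$ be a learning algorithm for it. Let $\bar\eta>0$ and suppose that the strong $\bar\eta$-central condition holds, i.e. $\mathbf E[e^{-\bar\eta L_f}]\le1$ for all $f\in\mathcal F$. For $0<\eta<\bar\eta$, $c\in(0,1]$ and $u>0$ write $c_u:=\frac1c\,\frac{\eta u+1}{1-\eta/\bar\eta}$. (i) If the $(u,c)$-witness condition holds (for some $u>0$, $c\in(0,1]$), then for any $\eta\in(0,\bar\eta)$ and every $n\ge1$, $$\mathbf E_{f\sim\Pi_n}\big[\mathbf E[L_f]\big]\ \trianglelefteq_{\eta n/c_u}\ c_u\cdot\mathrm{IC}_{n,\eta}(\Pi_|).$$ (ii) If instead the $(\tau,c)$-witness condition holds for some non-increasing function $\tau$ and some $c\in(0,1]$, then for any $\eta\in(0,\bar\eta)$, any $\lambda>0$ and every $n\ge1$, $$\mathbf E_{f\sim\Pi_n}\big[\mathbf E[L_f]\big]\ \trianglelefteq_{\eta n/c_{\tau(\lambda)}}\ \lambda+c_{\tau(\lambda)}\cdot\mathrm{IC}_{n,\eta}(\Pi_|).$$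
   Context: Learning problem $(P,\ell,\mathcal F)$: $P$ is a probability distribution on a measurable sample space $\mathcal Z$; $\mathcal F$ is a set (the model); $\ell:\mathcal F\times\mathcal Z\to\mathbb R\cup\{\infty\}$ is a loss, $\ell_f(z):=\ell(f,z)$; $\ell_f$ also denotes the random variable $\ell_f(Z)$ with $Z\sim P$; $\mathbf E$ is expectation under $P$. Standing assumptions: (1) unless $\ell$ is (conditional) log loss, $\inf_{f\in\mathcal F}\inf_{z\in\mathcal Z}\ell_f(z)>-\infty$; (2) if $\ell$ is (conditional) log loss $\ell_f=-\log p_f$, all $p_f$ are probability densities relative to a common dominating measure $\mu$, $P\ll\mu$, $\mathrm{KL}(P\|P_{f^*})<\infty$ and the differential entropy of $P$ relative to $\mu$ is $>-\infty$; (3) $\mathbf E[\ell_f]<\infty$ for some $f\in\mathcal F$; (4) there is an optimal $f^*\in\mathcal F$, i.e. $\mathbf E[\ell_f-\ell_{f^*}]\ge 0$ for all $f\in\mathcal F$; one such $f^*$ is fixed. Excess loss: $L_f:=\ell_f-\ell_{f^*}$. Learning algorithm $\Pi_|$: a function mapping each sample $z^n\in\mathcal Z^n$, $n=0,1,2,\dots$, to a probability distribution on $\mathcal F$. $\Pi_n$ denotes the output on $Z^n=(Z_1,\dots,Z_n)$, with $Z_1,\dots,Z_n$ i.i.d. $\sim P$; $\Pi_0$ (output on the empty sample) is called the prior. It is assumed that $\Pi_n$ always has a density relative to $\Pi_0$ and that $\Pi_0(\{f:\ell_f(z)<\infty\})>0$ for all $z\in\mathcal Z$. In $\mathbf E_{f\sim\Pi_n}[\mathbf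 E[L_f]]$ the inner expectation is over a fresh $Z\sim P$ independent of $Z^n$. Information complexity (a random variable depending on $Z^n$): $\mathrm{IC}_{n,\eta}(\Pi_|):=\mathbf E_{f\sim\Pi_n}\big[\frac1n\sum_{i=1}^n L_f(Z_i)\big]+\frac{\mathrm{KL}(\Pi_n\|\Pi_0)}{\eta n}$. Exponential stochastic inequality (ESI): $U\trianglelefteq_\eta U'$ means $\mathbf E[e^{\eta(U-U')}]\le1$ (here the expectation is over $Z^n\sim P^n$). Witness conditions: the $(u,c)$-witness condition holds if for all $f\in\mathcal F$, $\mathbf E[L_f\cdot\mathbf 1_{\{L_f\le u\}}]\ge c\,\mathbf E[L_f]$. For a function $\tau:[0,\infty)\to[1,\infty)$, the $(\tau,c)$-witness condition holds if for all $f\in\mathcal F$, $\mathbf E[L_f]<\infty$ and $\mathbf E[L_f\cdot\mathbf 1_{\{L_f\le\tau(\mathbf E[L_f])\}}]\ge c\,\mathbf E[L_f]$. *)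

theory Defs
  imports "HOL-Probability.Probability"
begin

section \<open>Extended-real expectations\<close>

text \<open>
  The losses take values in \<open>\<real> \<union> {\<infinity>}\<close> and the expectations of interest may be infinite, whereas
  the Bochner integral is real-valued and \<open>0\<close> on non-integrable functions.  The expectation below
  is the difference of the integrals of the positive and the negative part; \<^const>\<open>e2ennreal\<close>
  maps negative numbers to \<open>0\<close>.  As everywhere in \<^typ>\<open>ereal\<close>, \<open>\<infinity> - \<infinity> = \<infinity>\<close>.
\<close>

definition expect :: "'a measure \<Rightarrow> ('a \<Rightarrow> ereal) \<Rightarrow> ereal" where
  "expect M X = enn2ereal (\<integral>\<^sup>+ x. e2ennreal (X x) \<partial>M) - enn2ereal (\<integral>\<^sup>+ x. e2ennreal (- X x) \<partial>M)"

lemma expect_eq_integral: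
  assumes "integrable M X"
  shows "expect M (\<lambda>x. ereal (X x)) = ereal (integral\<^sup>L M X)"
proof -
  have fin: "(\<integral>\<^sup>+ x. ennreal (X x) \<partial>M) \<noteq> \<infinity>" "(\<integral>\<^sup>+ x. ennreal (- X x) \<partial>M) \<noteq> \<infinity>"
    using assms by (auto simp: real_integrable_def)
  have e: "enn2ereal a = ereal (enn2real a)" if "a \<noteq> \<infinity>" for a
    using that by (cases a) (auto simp: enn2ereal_ennreal)
  show ?thesis
    unfolding expect_def real_lebesgue_integral_def[OF assms]
    using fin by (simp add: e)
qed

definition exp_ereal :: "ereal \<Rightarrow> ennreal" where
  "exp_ereal x = (case x of ereal r \<Rightarrow> ennreal (exp r) | PInfty \<Rightarrow> \<infinity> | MInfty \<Rightarrow> 0)"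

text \<open>Minus the natural logarithm on \<open>[0,\<infinity>)\<close>; HOL's \<open>ln 0\<close> is \<open>0\<close>, so the value \<open>\<infinity>\<close> at \<open>0\<close> has to
  be given explicitly.\<close>

definition neg_ln :: "real \<Rightarrow> ereal" where
  "neg_ln x = (if x = 0 then \<infinity> else ereal (- ln x))"

text \<open>\<open>kl N M\<close> is \<open>KL(N \<parallel> M)\<close>, in nats; the arguments are in the opposite order to \<^const>\<open>KL_divergence\<close>,
  which is real-valued and hence cannot be infinite.\<close>

definition kl :: "'a measure \<Rightarrow> 'a measure \<Rightarrow> ereal" where
  "kl N M = (if sets N = sets M \<and> absolutely_continuous M N
             then expect N (\<lambda>x. ereal (entropy_density (exp 1) M N x)) else \<infinity>)"

lemma kl_eq_KL_divergence:
  assumes "sets N = sets M" "absolutely_continuous M N"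
    and "integrable N (entropy_density (exp 1) M N)"
  shows "kl N M = ereal (KL_divergence (exp 1) M N)"
  using assms by (simp add: kl_def KL_divergence_def expect_eq_integral)

definition diff_entropy :: "'a measure \<Rightarrow> 'a measure \<Rightarrow> ereal" where
  "diff_entropy \<mu> P = - expect P (\<lambda>z. ereal (entropy_density (exp 1) \<mu> P z))"


section \<open>Exponential stochastic inequality\<close>

text \<open>
  A learning algorithm below is an arbitrary function of the sample, so the random variables in an
  ESI need not be measurable.  On non-measurable functions \<^const>\<open>nn_integral\<close> is a lower integral,
  for which \<open>\<le> 1\<close> would say too little; hence the upper integral is used.  It is the usual
  expectation for measurable functions.
\<close>

definition upper_nn_integral :: "'a measure \<Rightarrow> ('a \<Rightarrow> ennreal) \<Rightarrow> ennreal" where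
  "upper_nn_integral M X =
     (INF Y\<in>{Y \<in> borel_measurable M. \<forall>\<omega>\<in>space M. X \<omega> \<le> Y \<omega>}. \<integral>\<^sup>+ \<omega>. Y \<omega> \<partial>M)"

lemma upper_nn_integral_measurable:
  assumes "X \<in> borel_measurable M"
  shows "upper_nn_integral M X = (\<integral>\<^sup>+ \<omega>. X \<omega> \<partial>M)"
  unfolding upper_nn_integral_def
proof (rule antisym)
  show "(INF Y\<in>{Y \<in> borel_measurable M. \<forall>\<omega>\<in>space M. X \<omega> \<le> Y \<omega>}. \<integral>\<^sup>+ \<omega>. Y \<omega> \<partial>M)
      \<le> (\<integral>\<^sup>+ \<omega>. X \<omega> \<partial>M)"
    using assms by (intro INF_lower) auto
  show "(\<integral>\<^sup>+ \<omega>. X \<omega> \<partial>M)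
      \<le> (INF Y\<in>{Y \<in> borel_measurable M. \<forall>\<omega>\<in>space M. X \<omega> \<le> Y \<omega>}. \<integral>\<^sup>+ \<omega>. Y \<omega> \<partial>M)"
    by (intro INF_greatest nn_integral_mono) auto
qed

definition esi :: "'a measure \<Rightarrow> real \<Rightarrow> ('a \<Rightarrow> ereal) \<Rightarrow> ('a \<Rightarrow> ereal) \<Rightarrow> bool" where
  "esi M \<eta> U V \<longleftrightarrow> upper_nn_integral M (\<lambda>\<omega>. exp_ereal (ereal \<eta> * (U \<omega> - V \<omega>))) \<le> 1"


section \<open>Learning problems\<close>

text \<open>
  The model is the space of the measure \<open>F\<close>, of which only the \<open>\<sigma>\<close>-algebra is used.

  Conditional log loss \<open>- log p\<^sub>f(y|x)\<close> with densities relative to \<open>\<nu>\<close> is the instance of log loss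
  in which \<open>\<mu>\<close> is the product of the marginal \<open>P\<^sub>X\<close> and \<open>\<nu>\<close>; see \<open>log_loss_setting_conditional\<close>.
\<close>

definition log_loss_setting ::
  "'z measure \<Rightarrow> 'f measure \<Rightarrow> ('f \<Rightarrow> 'z \<Rightarrow> ereal) \<Rightarrow> 'f \<Rightarrow> bool" where
  "log_loss_setting P F loss fstar \<longleftrightarrow>
     (\<exists>\<mu> p. sigma_finite_measure \<mu> \<and> sets \<mu> = sets P
        \<and> (\<forall>f\<in>space F. p f \<in> borel_measurable \<mu> \<and> (\<forall>z\<in>space P. 0 \<le> p f z)
              \<and> (\<integral>\<^sup>+ z. ennreal (p f z) \<partial>\<mu>) = 1)
        \<and> (\<forall>f\<in>space F. \<forall>z\<in>space P. loss f z = neg_ln (p f z))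
        \<and> absolutely_continuous \<mu> P
        \<and> kl P (density \<mu> (\<lambda>z. ennreal (p fstar z))) < \<infinity>
        \<and> diff_entropy \<mu> P > -\<infinity>)"

lemma log_loss_setting_conditional:
  fixes p :: "'f \<Rightarrow> 'x \<Rightarrow> 'y \<Rightarrow> real" and \<nu> :: "'y measure" and S :: "'x measure"
    and P :: "('x \<times> 'y) measure" and F :: "'f measure"
  defines "\<mu> \<equiv> distr P S fst \<Otimes>\<^sub>M \<nu>"
  assumes P: "prob_space P" "sets P = sets (S \<Otimes>\<^sub>M \<nu>)" and \<nu>: "sigma_finite_measure \<nu>"
    and p: "\<And>f. f \<in> space F \<Longrightarrow> (\<lambda>(x, y). p f x y) \<in> borel_measurable (S \<Otimes>\<^sub>M \<nu>)"
      "\<And>f x y. f \<in> space F \<Longrightarrow> x \<in> space S \<Longrightarrow> y \<in> space \<nu> \<Longrightarrow> 0 \<le> p f x y"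
      "\<And>f x. f \<in> space F \<Longrightarrow> x \<in> space S \<Longrightarrow> (\<integral>\<^sup>+ y. ennreal (p f x y) \<partial>\<nu>) = 1"
    and loss: "\<And>f x y. f \<in> space F \<Longrightarrow> x \<in> space S \<Longrightarrow> y \<in> space \<nu> \<Longrightarrow> loss f (x, y) = neg_ln (p f x y)"
    and "absolutely_continuous \<mu> P"
    and "kl P (density \<mu> (\<lambda>(x, y). ennreal (p fstar x y))) < \<infinity>"
    and "diff_entropy \<mu> P > -\<infinity>"
  shows "log_loss_setting P F loss fstar"
proof -
  interpret P: prob_space P by fact
  interpret \<nu>: sigma_finite_measure \<nu> by fact
  have [measurable]: "fst \<in> measurable P S"
    using measurable_fst[of S \<nu>] P(2) by (simp cong: measurable_cong_sets)
  interpret X: prob_space "distr P S fst" by (rule P.prob_space_distr) simp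
  interpret pair_sigma_finite "distr P S fst" \<nu> ..
  have sets: "sets \<mu> = sets P"
    unfolding \<mu>_def P(2) by (intro sets_pair_measure_cong) auto
  have space: "space P = space S \<times> space \<nu>"
    using sets_eq_imp_space_eq[OF P(2)] by (simp add: space_pair_measure)
  have meas: "(\<lambda>(x, y). p f x y) \<in> borel_measurable \<mu>" if "f \<in> space F" for f
    using p(1)[OF that] sets P(2) by (simp cong: measurable_cong_sets)
  have one: "(\<integral>\<^sup>+ z. ennreal (case z of (x, y) \<Rightarrow> p f x y) \<partial>\<mu>) = 1" if f: "f \<in> space F" for f
  proof -
    have "(\<lambda>z. ennreal (case z of (x, y) \<Rightarrow> p f x y)) \<in> borel_measurable (distr P S fst \<Otimes>\<^sub>M \<nu>)"
      using meas[OF f] unfolding \<mu>_def by measurable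
    then have "(\<integral>\<^sup>+ z. ennreal (case z of (x, y) \<Rightarrow> p f x y) \<partial>\<mu>)
        = (\<integral>\<^sup>+ x. \<integral>\<^sup>+ y. ennreal (p f x y) \<partial>\<nu> \<partial>distr P S fst)"
      unfolding \<mu>_def by (subst \<nu>.nn_integral_fst[symmetric]) auto
    also have "\<dots> = (\<integral>\<^sup>+ x. 1 \<partial>distr P S fst)"
      using p(3)[OF f] by (intro nn_integral_cong) simp
    finally show ?thesis using X.emeasure_space_1 by simp
  qed
  have dens: "(\<lambda>z. ennreal (case z of (x, y) \<Rightarrow> p fstar x y)) = (\<lambda>(x, y). ennreal (p fstar x y))"
    by auto
  have sf: "sigma_finite_measure \<mu>"
    unfolding \<mu>_def by unfold_locales
  show ?thesis
    unfolding log_loss_setting_def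
  proof (intro exI[of _ \<mu>] exI[of _ "\<lambda>f (x, y). p f x y"] conjI ballI)
    fix f assume f: "f \<in> space F"
    show "(\<lambda>(x, y). p f x y) \<in> borel_measurable \<mu>" by (rule meas[OF f])
    show "(\<integral>\<^sup>+ z. ennreal (case z of (x, y) \<Rightarrow> p f x y) \<partial>\<mu>) = 1" by (rule one[OF f])
    fix z assume "z \<in> space P"
    then show "0 \<le> (case z of (x, y) \<Rightarrow> p f x y)" "loss f z = neg_ln (case z of (x, y) \<Rightarrow> p f x y)"
      using p(2) loss f by (auto simp: space)
  qed (use assms sets sf dens in auto)
qed

definition excess_loss :: "('f \<Rightarrow> 'z \<Rightarrow> ereal) \<Rightarrow> 'f \<Rightarrow> 'f \<Rightarrow> 'z \<Rightarrow> ereal" where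
  "excess_loss loss fstar f z = loss f z - loss fstar z"

locale learning_problem = prob_space P
  for P :: "'z measure" +
  fixes F :: "'f measure" and loss :: "'f \<Rightarrow> 'z \<Rightarrow> ereal" and fstar :: 'f
  assumes loss_measurable: "(\<lambda>(f, z). loss f z) \<in> borel_measurable (F \<Otimes>\<^sub>M P)"
    and loss_not_MInfty: "\<And>f z. f \<in> space F \<Longrightarrow> z \<in> space P \<Longrightarrow> loss f z \<noteq> -\<infinity>"
    and bounded_below_or_log_loss:
      "(INF f\<in>space F. INF z\<in>space P. loss f z) > -\<infinity> \<or> log_loss_setting P F loss fstar"
    and ex_finite_risk: "\<exists>f\<in>space F. expect P (loss f) < \<infinity>"
    and fstar_in: "fstar \<in> space F"
    and fstar_optimal: "\<And>f. f \<in> space F \<Longrightarrow> expect P (excess_loss loss fstar f) \<ge> 0"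

definition strong_central ::
  "'z measure \<Rightarrow> 'f measure \<Rightarrow> ('f \<Rightarrow> 'z \<Rightarrow> ereal) \<Rightarrow> 'f \<Rightarrow> real \<Rightarrow> bool" where
  "strong_central P F loss fstar \<eta> \<longleftrightarrow>
     (\<forall>f\<in>space F. (\<integral>\<^sup>+ z. exp_ereal (- ereal \<eta> * excess_loss loss fstar f z) \<partial>P) \<le> 1)"

definition witness ::
  "'z measure \<Rightarrow> 'f measure \<Rightarrow> ('f \<Rightarrow> 'z \<Rightarrow> ereal) \<Rightarrow> 'f \<Rightarrow> real \<Rightarrow> real \<Rightarrow> bool" where
  "witness P F loss fstar u c \<longleftrightarrow>
     (\<forall>f\<in>space F. let L = excess_loss loss fstar f in
        expect P (\<lambda>z. L z * indicator {z. L z \<le> ereal u} z) \<ge> ereal c * expect P L)"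

text \<open>\<^const>\<open>real_of_ereal\<close> is applied to an expectation only where it is finite.\<close>

definition witness_fun ::
  "'z measure \<Rightarrow> 'f measure \<Rightarrow> ('f \<Rightarrow> 'z \<Rightarrow> ereal) \<Rightarrow> 'f \<Rightarrow> (real \<Rightarrow> real) \<Rightarrow> real \<Rightarrow> bool" where
  "witness_fun P F loss fstar \<tau> c \<longleftrightarrow>
     (\<forall>f\<in>space F. let L = excess_loss loss fstar f in
        expect P L < \<infinity> \<and>
        expect P (\<lambda>z. L z * indicator {z. L z \<le> ereal (\<tau> (real_of_ereal (expect P L)))} z)
          \<ge> ereal c * expect P L)"


section \<open>Learning algorithms\<close>

text \<open>A sample of size \<open>n\<close> is a list of length \<open>n\<close>; \<open>A []\<close> is the prior.\<close>

definition learning_algorithm ::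
  "'z measure \<Rightarrow> 'f measure \<Rightarrow> ('f \<Rightarrow> 'z \<Rightarrow> ereal) \<Rightarrow> ('z list \<Rightarrow> 'f measure) \<Rightarrow> bool" where
  "learning_algorithm P F loss A \<longleftrightarrow>
     (\<forall>zs\<in>lists (space P). prob_space (A zs) \<and> sets (A zs) = sets F
        \<and> (\<exists>\<rho>\<in>borel_measurable (A []). A zs = density (A []) \<rho>))
     \<and> (\<forall>z\<in>space P. emeasure (A []) {f\<in>space F. loss f z < \<infinity>} > 0)"

definition information_complexity ::
  "('f \<Rightarrow> 'z \<Rightarrow> ereal) \<Rightarrow> 'f \<Rightarrow> ('z list \<Rightarrow> 'f measure) \<Rightarrow> real \<Rightarrow> 'z list \<Rightarrow> ereal" where
  "information_complexity loss fstar A \<eta> zs =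
     expect (A zs) (\<lambda>f. (\<Sum>i<length zs. excess_loss loss fstar f (zs ! i)) / ereal (real (length zs)))
     + kl (A zs) (A []) / ereal (\<eta> * real (length zs))"

definition posterior_excess_risk ::
  "'z measure \<Rightarrow> ('f \<Rightarrow> 'z \<Rightarrow> ereal) \<Rightarrow> 'f \<Rightarrow> ('z list \<Rightarrow> 'f measure) \<Rightarrow> 'z list \<Rightarrow> ereal" where
  "posterior_excess_risk P loss fstar A zs = expect (A zs) (\<lambda>f. expect P (excess_loss loss fstar f))"

definition c_witness :: "real \<Rightarrow> real \<Rightarrow> real \<Rightarrow> real \<Rightarrow> real" where
  "c_witness \<eta>bar \<eta> c u = 1 / c * ((\<eta> * u + 1) / (1 - \<eta> / \<eta>bar))"

text \<open>\<open>P\<^sup>n\<close>, whose coordinates are the i.i.d. observations, and the sample as a list.\<close>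

abbreviation iid :: "nat \<Rightarrow> 'z measure \<Rightarrow> (nat \<Rightarrow> 'z) measure" where
  "iid n P \<equiv> PiM {..<n} (\<lambda>_. P)"

abbreviation sample :: "nat \<Rightarrow> (nat \<Rightarrow> 'z) \<Rightarrow> 'z list" where
  "sample n \<omega> \<equiv> map \<omega> [0..<n]"

end

theory Submission
  imports Defs
begin

text \<open>
  The central condition says that \<open>(1 - exp (- \<eta>bar L)) / \<eta>bar\<close> has nonnegative expectation.  A pointwise
  bound of \<open>L\<close>, truncated at \<open>u\<close>, by a combination of this function and of \<open>(1 - exp (- \<eta> L)) / \<eta>\<close>
  therefore turns the witness condition into
  \<open>E L \<le> cu (1 - E exp (- \<eta> L)) / \<eta>\<close>, so that \<open>exp (\<eta> E L / cu) E exp (- \<eta> L) \<le> 1\<close>.  In part (ii) the same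
  holds with \<open>E L - lam\<close> for \<open>E L\<close>, trivially when \<open>E L < lam\<close>.  Taking \<open>n\<close>-fold products, averaging over the
  prior, exchanging the integrals, and changing from prior to posterior by the Donsker-Varadhan
  inequality gives the claim.
\<close>

section \<open>Pointwise inequalities between a truncated variable and exponentials\<close>

text \<open>Convexity of exp: \<open>- (a * x)\<close> sits at weight \<open>a / b\<close> on the
  segment from 0 to \<open>- (b * x)\<close>, so exp there lies below the chord.\<close>

lemma hellinger_antimono:
  fixes a b x :: real
  assumes "0 < a" "a \<le> b"
  shows "(1 - exp (- (b * x))) / b \<le> (1 - exp (- (a * x))) / a"
proof -
  have "exp ((1 - a / b) *\<^sub>R 0 + (a / b) *\<^sub>R (- (b * x)))
      \<le> (1 - a / b) * exp 0 + (a / b) * exp (- (b * x))"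
    by (rule convex_onD[OF exp_convex]) (use assms in auto)
  then have "exp (- (a * x)) \<le> 1 - a / b + (a / b) * exp (- (b * x))"
    using assms by simp
  then have "a * ((1 - exp (- (b * x))) / b) \<le> 1 - exp (- (a * x))"
    by (simp add: algebra_simps diff_divide_distrib)
  then show ?thesis
    using assms by (simp add: pos_le_divide_eq mult.commute)
qed

text \<open>This is the truncation bound for threshold \<open>u = x\<close>, multiplied by
  \<open>(b - a) * a * b\<close>; the terms linear in \<open>x\<close> have cancelled. The
  expression vanishes at 0 and increases, because
  \<open>exp (- (b * y)) \<le> exp (- (a * y))\<close> for \<open>y \<ge> 0\<close>.\<close>

lemma tangent_inequality_nonneg:
  fixes a b x :: real
  assumes "0 < a" "a < b" "0 \<le> x"
  shows "0 \<le> b\<^sup>2 * (1 - (1 + a * x) * exp (- (a * x))) - a\<^sup>2 * (1 - (1 + b * x) * exp (- (b * x)))"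
    (is "0 \<le> ?G x")
proof -
  have "?G 0 \<le> ?G x"
  proof (rule DERIV_nonneg_imp_nondecreasing[OF assms(3)])
    fix y :: real
    assume y: "0 \<le> y" "y \<le> x"
    let ?D = "a\<^sup>2 * b\<^sup>2 * y * (exp (- (a * y)) - exp (- (b * y)))"
    have "(?G has_real_derivative ?D) (at y)"
      by (auto intro!: derivative_eq_intros simp: algebra_simps power2_eq_square)
    moreover have "0 \<le> ?D"
      using y assms by (intro mult_nonneg_nonneg) (auto intro: mult_right_mono)
    ultimately show "\<exists>D. (?G has_real_derivative D) (at y) \<and> 0 \<le> D" by blast
  qed
  then show ?thesis by simp
qed

text \<open>The same bound for threshold \<open>u = 0\<close>. By \<open>hellinger_antimono\<close>
  the derivative is nonpositive on the whole line, so left of 0 the expression is at least its value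
  0 at 0.\<close>

lemma tangent_inequality_nonpos:
  fixes a b x :: real
  assumes "0 < a" "a < b" "x \<le> 0"
  shows "0 \<le> b\<^sup>2 * (1 - exp (- (a * x))) - a\<^sup>2 * (1 - exp (- (b * x))) - a * b * x * (b - a)"
    (is "0 \<le> ?H x")
proof -
  have "?H x \<ge> ?H 0"
  proof (rule DERIV_nonpos_imp_nonincreasing[OF assms(3)])
    fix y :: real
    let ?D = "a * b * (b * exp (- (a * y)) - a * exp (- (b * y)) - (b - a))"
    have "(?H has_real_derivative ?D) (at y)"
      by (auto intro!: derivative_eq_intros simp: algebra_simps power2_eq_square)
    moreover have "a * (1 - exp (- (b * y))) \<le> b * (1 - exp (- (a * y)))"
      using hellinger_antimono[of a b y] assms by (simp add: field_simps)
    then have "?D \<le> 0"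
      using assms by (intro mult_nonneg_nonpos) (auto simp: algebra_simps)
    ultimately show "\<exists>D. (?H has_real_derivative D) (at y) \<and> D \<le> 0" by blast
  qed
  then show ?thesis by simp
qed

text \<open>The coefficients on the right differ by \<open>1\<close> so that both sides are tangent at \<open>x = 0\<close>.  The right-hand
  side increases with \<open>C\<close>, so on \<open>x \<le> u\<close> it suffices to take the smallest admissible bound:
  \<open>u = 0\<close> for \<open>x \<le> 0\<close> and \<open>u = x\<close> otherwise.\<close>

lemma truncation_le_hellinger:
  fixes a b u x C :: real
  assumes ab: "0 < a" "a < b" and u: "0 \<le> u"
  defines "C \<equiv> (a * u + 1) / (1 - a / b)"
  shows "(if x \<le> u then x else 0)
      \<le> C * ((1 - exp (- (a * x))) / a) - (C - 1) * ((1 - exp (- (b * x))) / b)"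
proof -
  define p q where "p = exp (- (a * x))" and "q = exp (- (b * x))"
  define S T where "S = (1 - p) / a" and "T = (1 - q) / b"
  have TS: "T \<le> S" unfolding S_def T_def p_def q_def using hellinger_antimono[of a b x] ab by simp
  have C: "C = (a * u + 1) * b / (b - a)" unfolding C_def using ab by (simp add: field_simps)
  have C0: "0 \<le> C" unfolding C using ab u by simp
  \<comment> \<open>\<open>D\<close> is the coefficient belonging to threshold \<open>v\<close>; the
    last premise is the conclusion with denominators cleared.\<close>
  have *: "x \<le> D * S - (D - 1) * T"
    if "0 \<le> v" "D = (a * v + 1) * b / (b - a)"
      "0 \<le> (1 + a * v) * b\<^sup>2 * (1 - p) - a\<^sup>2 * (1 + b * v) * (1 - q) - a * b * x * (b - a)" for D v
  proof -
    have "(b - a) * D = (a * v + 1) * b" "a * S = 1 - p" "b * T = 1 - q"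
      unfolding S_def T_def that(2) using ab by simp_all
    then have "(b - a) * a * b * (D * S - (D - 1) * T - x)
      = (1 + a * v) * b\<^sup>2 * (1 - p) - a\<^sup>2 * (1 + b * v) * (1 - q) - a * b * x * (b - a)"
      by algebra
    then have "0 \<le> (b - a) * a * b * (D * S - (D - 1) * T - x)" using that by simp
    moreover have "0 < (b - a) * a * b" using ab by simp
    ultimately have "0 \<le> D * S - (D - 1) * T - x" by (simp only: zero_le_mult_iff) linarith
    then show ?thesis by simp
  qed
  \<comment> \<open>The expression is affine in \<open>D\<close> with slope
    \<open>S - T \<ge> 0\<close>.\<close>
  have mono: "D * S - (D - 1) * T \<le> C * S - (C - 1) * T" if "D \<le> C" for D
    using mult_right_mono[OF that, of "S - T"] TS by (simp add: algebra_simps)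
  consider "x \<le> 0" | "0 < x" "x \<le> u" | "u < x" by linarith
  then show ?thesis
  proof cases
    case 1
    have "x \<le> (b / (b - a)) * S - (b / (b - a) - 1) * T"
      by (rule *[of 0]) (use tangent_inequality_nonpos[OF ab 1] in \<open>auto simp: p_def q_def\<close>)
    also have "\<dots> \<le> C * S - (C - 1) * T"
      unfolding C using ab u by (intro mono[unfolded C] divide_right_mono) auto
    finally show ?thesis using 1 u by (simp add: S_def T_def p_def q_def)
  next
    case 2
    have "x \<le> ((a * x + 1) * b / (b - a)) * S - ((a * x + 1) * b / (b - a) - 1) * T"
      by (rule *[of x])
        (use tangent_inequality_nonneg[OF ab, of x] 2 in
          \<open>auto simp: p_def q_def algebra_simps power2_eq_square\<close>)
    also have "\<dots> \<le> C * S - (C - 1) * T"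
      unfolding C using ab u 2
      by (intro mono[unfolded C] divide_right_mono mult_right_mono) auto
    finally show ?thesis using 2 by (simp add: S_def T_def p_def q_def)
  next
    case 3
    \<comment> \<open>Beyond the threshold the left side is 0 and the right side is
      \<open>C * (S - T) + T\<close>, a sum of nonnegative terms as \<open>x > 0\<close>.\<close>
    have "q \<le> 1" unfolding q_def using 3 u ab by simp
    then have "0 \<le> T" unfolding T_def using ab by simp
    moreover have "0 \<le> C * (S - T)" using C0 TS by simp
    ultimately have "0 \<le> C * S - (C - 1) * T" by (simp add: algebra_simps)
    then show ?thesis using 3 by (simp add: S_def T_def p_def q_def)
  qed
qed

section \<open>Extended-real exponentials, expectations and upper integrals\<close>

lemma exp_ereal_simps [simp]:
  "exp_ereal (ereal r) = ennreal (exp r)" "exp_ereal \<infinity> = \<infinity>" "exp_ereal (-\<infinity>) = 0"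
  by (simp_all add: exp_ereal_def)

lemma measurable_exp_ereal [measurable]: "exp_ereal \<in> borel_measurable borel"
proof -
  have "exp_ereal = (\<lambda>x. if x = \<infinity> then \<infinity> else if x = -\<infinity> then 0 else ennreal (exp (real_of_ereal x)))"
    by (auto simp: exp_ereal_def fun_eq_iff split: ereal.split)
  also have "\<dots> \<in> borel_measurable borel" by measurable
  finally show ?thesis .
qed

lemma sum_ereal_not_MInfty:
  fixes X :: "'a \<Rightarrow> ereal"
  assumes "\<And>i. i \<in> I \<Longrightarrow> X i \<noteq> -\<infinity>"
  shows "sum X I \<noteq> -\<infinity>"
  using assms by (induction I rule: infinite_finite_induct) auto

text \<open>Positive and negative parts are compared separately; under
  \<open>\<infinity> - \<infinity> = \<infinity>\<close> the difference stays monotone in its first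
  and antitone in its second argument at infinite values.\<close>

lemma expect_mono_AE:
  assumes "AE x in M. X x \<le> Y x"
  shows "expect M X \<le> expect M Y"
proof -
  have "AE x in M. e2ennreal (X x) \<le> e2ennreal (Y x)"
    using assms by eventually_elim (rule e2ennreal_mono)
  moreover have "AE x in M. e2ennreal (- Y x) \<le> e2ennreal (- X x)"
    using assms by eventually_elim (rule e2ennreal_mono, simp only: ereal_minus_le_minus)
  ultimately show ?thesis
    unfolding expect_def
    by (intro ereal_minus_mono iffD1[OF less_eq_ennreal.rep_eq] nn_integral_mono_AE)
qed

lemma expect_cong_AE:
  assumes "AE x in M. X x = Y x"
  shows "expect M X = expect M Y"
  by (rule antisym; rule expect_mono_AE; use assms in eventually_elim; simp)

text \<open>The upper integral admits only majorants valid everywhere. Raising \<open>Y\<close> to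
  \<open>\<infinity>\<close> on a measurable null set containing the exceptional points produces one
  with the same integral.\<close>

lemma upper_nn_integral_le_AE:
  assumes [measurable]: "Y \<in> borel_measurable M" and "AE x in M. X x \<le> Y x"
  shows "upper_nn_integral M X \<le> (\<integral>\<^sup>+ x. Y x \<partial>M)"
proof -
  from AE_E[OF assms(2)] obtain N
    where N: "{x \<in> space M. \<not> X x \<le> Y x} \<subseteq> N" "emeasure M N = 0" "N \<in> sets M"
    by auto
  note N(3)[measurable]
  let ?Z = "\<lambda>x. Y x + \<infinity> * indicator N x"
  have "upper_nn_integral M X \<le> (\<integral>\<^sup>+ x. ?Z x \<partial>M)"
    unfolding upper_nn_integral_def
  proof (rule INF_lower, safe)
    show "?Z \<in> borel_measurable M" by measurable
    fix x assume "x \<in> space M"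
    then show "X x \<le> ?Z x" using N(1) by (cases "x \<in> N") auto
  qed
  also have "\<dots> = (\<integral>\<^sup>+ x. Y x \<partial>M)"
    using N by (subst nn_integral_add) (auto simp: nn_integral_cmult_indicator)
  finally show ?thesis .
qed

lemma (in prob_space) truncated_expect_le_hellinger:
  fixes L :: "'a \<Rightarrow> ereal" and a b u :: real
  assumes [measurable]: "L \<in> borel_measurable M"
    and ab: "0 < a" "a < b" and u: "0 \<le> u"
    and central: "(\<integral>\<^sup>+ z. exp_ereal (- ereal b * L z) \<partial>M) \<le> 1"
  defines "m \<equiv> \<integral>\<^sup>+ z. exp_ereal (- ereal a * L z) \<partial>M"
  shows "m \<le> 1"
    and "expect M (\<lambda>z. L z * indicator {z. L z \<le> ereal u} z)
      \<le> ereal ((a * u + 1) / (1 - a / b) * ((1 - enn2real m) / a))"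
proof -
  define C where "C = (a * u + 1) / (1 - a / b)"
  have C1: "1 \<le> C"
    unfolding C_def using ab u by (subst pos_le_divide_eq) (auto simp: add_increasing)
  \<comment> \<open>A real-valued version of the exponential, so that Bochner integrals can be added
    and subtracted. It is 0 at \<open>L z = \<infinity>\<close>, and
    \<open>L z = -\<infinity>\<close> has probability 0 because the exponential at \<open>b\<close>
    is infinite there.\<close>
  define q where "q s z = enn2real (exp_ereal (- ereal s * L z))" for s z
  have [measurable]: "q s \<in> borel_measurable M" for s
    unfolding q_def by measurable
  have "AE z in M. exp_ereal (- ereal b * L z) \<noteq> \<infinity>"
    using central by (intro nn_integral_noteq_infinite) (auto simp: top_unique)
  then have L: "AE z in M. L z \<noteq> -\<infinity>"
    by eventually_elim (use ab in auto)
  have q_eq: "exp_ereal (- ereal s * L z) = ennreal (q s z)" if "0 < s" "L z \<noteq> -\<infinity>" for s z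
    unfolding q_def using that by (cases "L z") auto
  have q_real: "q s z = exp (- (s * x))" if "L z = ereal x" for s z x
    unfolding q_def that by simp
  have q_inf: "q s z = 0" if "0 < s" "L z = \<infinity>" for s z
    unfolding q_def using that by simp
  have q_nonneg: "0 \<le> q s z" for s z unfolding q_def by simp
  have nn: "(\<integral>\<^sup>+ z. exp_ereal (- ereal s * L z) \<partial>M) = (\<integral>\<^sup>+ z. ennreal (q s z) \<partial>M)" if "0 < s" for s
    by (rule nn_integral_cong_AE) (use L q_eq that in auto)
  have int_b: "integrable M (q b)"
    by (rule integrableI_nonneg)
      (use central nn[of b] ab q_nonneg in \<open>auto simp: less_top[symmetric] top_unique\<close>)
  have b1: "(\<integral>z. q b z \<partial>M) \<le> 1"
    using central ab nn[of b] q_nonneg by (intro integral_real_bounded) auto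
  \<comment> \<open>\<open>hellinger_antimono\<close> rearranged: an affine function of
    \<open>q b\<close> dominates \<open>q a\<close>, which gives both integrability and mean at most
    1.\<close>
  have q_le: "q a z \<le> 1 - a / b * (1 - q b z)" if "L z \<noteq> -\<infinity>" for z
  proof (cases "L z")
    case (real x)
    then show ?thesis
      using hellinger_antimono[of a b x] ab by (simp add: q_real field_simps)
  qed (use that ab in \<open>auto simp: q_inf field_simps\<close>)
  have int_a: "integrable M (q a)"
  proof (rule Bochner_Integration.integrable_bound)
    show "integrable M (\<lambda>z. 1 - a / b * (1 - q b z))" using int_b by simp
    show "AE z in M. norm (q a z) \<le> norm (1 - a / b * (1 - q b z))"
      using L
    proof eventually_elim
      case (elim z)
      show ?case using q_le[OF elim] q_nonneg[of a z] by simp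
    qed
  qed simp
  have m: "m = ennreal (\<integral>z. q a z \<partial>M)"
    unfolding m_def using nn[of a] ab int_a q_nonneg by (simp add: nn_integral_eq_integral)
  have "(\<integral>z. q a z \<partial>M) \<le> (\<integral>z. 1 - a / b * (1 - q b z) \<partial>M)"
    by (rule integral_mono_AE) (use int_a int_b L q_le in auto)
  also have "\<dots> = 1 - a / b * (1 - (\<integral>z. q b z \<partial>M))"
    using int_b by (simp add: prob_space)
  also have "\<dots> \<le> 1" using b1 ab by simp
  finally show "m \<le> 1" unfolding m by simp
  define Y where "Y z = C * ((1 - q a z) / a) - (C - 1) * ((1 - q b z) / b)" for z
  have "expect M (\<lambda>z. L z * indicator {z. L z \<le> ereal u} z) \<le> expect M (\<lambda>z. ereal (Y z))"
  proof (rule expect_mono_AE)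
    show "AE z in M. L z * indicator {z. L z \<le> ereal u} z \<le> ereal (Y z)"
      using L
    proof eventually_elim
      case (elim z)
      show ?case
      proof (cases "L z")
        case (real x)
        then show ?thesis
          using truncation_le_hellinger[OF ab u, of x]
          by (auto simp: Y_def C_def q_real zero_ereal_def split: if_splits)
      next
        case PInf
        \<comment> \<open>Here the truncated loss is \<open>\<infinity> * 0 = 0\<close> and both
          exponentials vanish, so it remains that \<open>C / a - (C - 1) / b\<close> is
          nonnegative.\<close>
        have "C * (1 / b) \<le> C * (1 / a)"
          using ab C1 by (intro mult_left_mono) (auto simp: frac_le)
        moreover have "0 \<le> 1 / b" using ab by simp
        ultimately have "0 \<le> C * (1 / a) - (C - 1) * (1 / b)"
          by (simp only: left_diff_distrib)
        then have "0 \<le> Y z" using PInf ab unfolding Y_def by (simp add: q_inf)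
        then show ?thesis using PInf by simp
      qed (use elim in simp)
    qed
  qed
  also have "\<dots> = ereal (integral\<^sup>L M Y)"
    unfolding Y_def using int_a int_b by (intro expect_eq_integral) simp
  also have "integral\<^sup>L M Y = C * ((1 - (\<integral>z. q a z \<partial>M)) / a) - (C - 1) * ((1 - (\<integral>z. q b z \<partial>M)) / b)"
    unfolding Y_def using int_a int_b by (simp add: prob_space)
  also have "\<dots> \<le> C * ((1 - enn2real m) / a)"
    using C1 b1 ab q_nonneg by (simp add: m)
  finally show "expect M (\<lambda>z. L z * indicator {z. L z \<le> ereal u} z)
      \<le> ereal ((a * u + 1) / (1 - a / b) * ((1 - enn2real m) / a))"
    unfolding C_def by simp
qed

section \<open>Change of measure from prior to posterior\<close>

text \<open>\<open>kl\<close> is computed from the Radon-Nikodym derivative, so that derivative,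
  made real-valued, is chosen as \<open>d\<close> in place of \<open>\<rho>\<close>; then the
  integrand of \<open>kl\<close> is literally \<open>ln (d x)\<close>.\<close>

lemma kl_density:
  assumes "prob_space M" "prob_space (density M \<rho>)" "\<rho> \<in> borel_measurable M"
  obtains d :: "'a \<Rightarrow> real" where "d \<in> borel_measurable M" "\<And>x. 0 \<le> d x"
    "density M \<rho> = density M (\<lambda>x. ennreal (d x))"
    "kl (density M \<rho>) M = expect (density M \<rho>) (\<lambda>x. ereal (ln (d x)))"
proof -
  interpret M: prob_space M by fact
  interpret N: prob_space "density M \<rho>" by fact
  let ?N = "density M \<rho>"
  let ?D = "RN_deriv M ?N"
  have ac: "absolutely_continuous M ?N" using assms(3) by (rule absolutely_continuousI_density)
  have "AE x in M. ?D x \<noteq> \<infinity>"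
    by (rule M.RN_deriv_finite) (use ac in \<open>auto intro: N.sigma_finite_measure_axioms\<close>)
  then have "density M (\<lambda>x. ennreal (enn2real (?D x))) = density M ?D"
    by (intro density_cong) (auto elim!: eventually_mono simp: less_top)
  also have "\<dots> = ?N"
    by (rule density_RN_deriv_density[OF assms(3)])
  finally have "density M (\<lambda>x. ennreal (enn2real (?D x))) = ?N" .
  moreover have "kl ?N M = expect ?N (\<lambda>x. ereal (ln (enn2real (?D x))))"
    using ac by (simp add: kl_def entropy_density_def log_def)
  ultimately show thesis by (intro that[of "\<lambda>x. enn2real (?D x)"]) auto
qed

text \<open>Only this half of the variational formula is needed.  It follows from \<open>t \<le> exp t - 1\<close>, applied to
  the exponent minus the logarithms of \<open>dN/dM\<close> and of the right-hand side; this bound also yields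
  the integrability of \<open>X\<close> when the right-hand side is finite.\<close>

lemma donsker_varadhan:
  fixes r :: "'a \<Rightarrow> real" and X :: "'a \<Rightarrow> ereal" and k c :: real
  assumes "prob_space M" "prob_space N" "N = density M \<rho>" "\<rho> \<in> borel_measurable M"
    and "0 < k" "0 < c"
    and X[measurable]: "X \<in> borel_measurable M" and X_not: "\<And>x. x \<in> space M \<Longrightarrow> X x \<noteq> -\<infinity>"
    and r: "integrable N r" and [measurable]: "r \<in> borel_measurable M"
  shows "exp_ereal (ereal (k / c) * (ereal (\<integral>x. r x \<partial>N) - ereal c * (expect N X + kl N M / ereal k)))
    \<le> (\<integral>\<^sup>+ x. exp_ereal (ereal k * (ereal (r x / c) - X x)) \<partial>M)" (is "?lhs \<le> ?W")
proof -
  interpret M: prob_space M by fact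
  interpret N: prob_space N by fact
  obtain d where [measurable]: "d \<in> borel_measurable M" and d_nonneg: "\<And>x. 0 \<le> d x"
    and N_d: "N = density M (\<lambda>x. ennreal (d x))"
    and kl: "kl N M = expect N (\<lambda>x. ereal (ln (d x)))"
    using kl_density[OF assms(1) _ assms(4)] assms(2,3) by metis
  have sets_N[measurable_cong, simp]: "sets N = sets M" unfolding N_d by simp
  have sp[simp]: "space N = space M" unfolding N_d by simp
  have d_pos: "AE x in N. 0 < d x"
    unfolding N_d by (subst AE_density) auto
  \<comment> \<open>Since \<open>- d * ln d \<le> 1\<close>, the negative part of
    \<open>ln d\<close> always has finite integral under \<open>N\<close>; hence the divergence is
    never \<open>-\<infinity>\<close>.\<close>
  have "(\<integral>\<^sup>+ x. ennreal (- ln (d x)) \<partial>N) = (\<integral>\<^sup>+ x. ennreal (d x) * ennreal (- ln (d x)) \<partial>M)"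
    unfolding N_d by (rule nn_integral_density) auto
  also have "\<dots> \<le> (\<integral>\<^sup>+ x. 1 \<partial>M)"
  proof (rule nn_integral_mono)
    fix x
    have "d x * (- ln (d x)) \<le> 1"
    proof (cases "d x = 0")
      case False
      then have "ln (1 / d x) \<le> 1 / d x - 1" using d_nonneg[of x] by (intro ln_le_minus_one) auto
      then have "d x * ln (1 / d x) \<le> d x * (1 / d x - 1)" using d_nonneg by (rule mult_left_mono)
      then show ?thesis using False d_nonneg[of x] by (simp add: ln_div algebra_simps)
    qed simp
    then show "ennreal (d x) * ennreal (- ln (d x)) \<le> 1"
      using d_nonneg[of x] by (simp add: ennreal_mult'[symmetric])
  qed
  finally have ln_neg: "(\<integral>\<^sup>+ x. ennreal (- ln (d x)) \<partial>N) < \<infinity>"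
    by (auto simp: M.emeasure_space_1 less_top[symmetric] top_unique)
  then have kl_not: "kl N M \<noteq> -\<infinity>"
    unfolding kl expect_def by (auto simp: minus_ereal_def less_top)
  \<comment> \<open>The exponent on the left is then \<open>-\<infinity>\<close> and the left side
    0. In \<open>ereal\<close> addition \<open>\<infinity>\<close> absorbs
    \<open>-\<infinity>\<close>, so one infinite summand suffices.\<close>
  have triv: ?thesis if "expect N X + kl N M / ereal k = \<infinity>"
    unfolding that using assms(5,6) by simp
  consider "kl N M = \<infinity>" | "expect N X = \<infinity>" | "?W = \<infinity>"
    | "kl N M \<noteq> \<infinity>" "expect N X \<noteq> \<infinity>" "?W \<noteq> \<infinity>" by blast
  then show ?thesis
  proof cases
    case 1
    then show ?thesis using assms(5) by (intro triv) simp
  next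
    case 2
    then show ?thesis by (intro triv) simp
  next
    case 3
    then show ?thesis by simp
  next
    case 4
    have "(\<integral>\<^sup>+ x. ennreal (ln (d x)) \<partial>N) \<noteq> \<infinity>"
      using 4(1) unfolding kl expect_def by auto
    then have int_ln: "integrable N (\<lambda>x. ln (d x))"
      using ln_neg by (simp add: real_integrable_def less_top)
    have X_pos: "(\<integral>\<^sup>+ x. e2ennreal (X x) \<partial>N) \<noteq> \<infinity>"
      using 4(2) unfolding expect_def by auto
    have "AE x in N. e2ennreal (X x) \<noteq> \<infinity>"
      by (rule nn_integral_noteq_infinite) (use X_pos in auto)
    then have X_fin: "AE x in N. X x \<noteq> \<infinity>"
      by eventually_elim auto
    define y where "y x = real_of_ereal (X x)" for x
    have [measurable]: "y \<in> borel_measurable M" unfolding y_def by measurable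
    have X_y: "AE x in N. X x = ereal (y x)"
      using X_fin AE_space[of N]
    proof eventually_elim
      case (elim x)
      then show ?case using X_not[of x] unfolding y_def by (cases "X x") auto
    qed
    \<comment> \<open>A zero value would force \<open>X = \<infinity>\<close> wherever
      \<open>d > 0\<close>, that is, \<open>N\<close>-almost everywhere. Positivity is what makes
      \<open>ln w\<close> meaningful below.\<close>
    have "?W \<noteq> 0"
    proof
      assume "?W = 0"
      then have "AE x in M. exp_ereal (ereal k * (ereal (r x / c) - X x)) = 0"
        by (subst (asm) nn_integral_0_iff_AE) auto
      then have "AE x in M. 0 < ennreal (d x) \<longrightarrow> X x = \<infinity>"
        using AE_space
      proof eventually_elim
        case (elim x)
        then show ?case using X_not[of x] by (cases "X x") auto
      qed
      then have "AE x in N. X x = \<infinity>" unfolding N_d by (subst AE_density) auto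
      with X_fin have "AE x in N. False" by eventually_elim simp
      then show False by simp
    qed
    then obtain w where w: "?W = ennreal w" "0 < w"
      using 4(3) by (cases ?W) (auto simp: less_le)
    \<comment> \<open>Chosen so that \<open>d * exp t\<close> is the integrand of \<open>?W\<close>
      divided by \<open>w\<close> where \<open>d > 0\<close>; points with \<open>d = 0\<close> add
      nothing on the left. Thus \<open>exp t\<close> has \<open>N\<close>-mean at most 1.\<close>
    define t where "t x = k * (r x / c - y x) - ln w - ln (d x)" for x
    have [measurable]: "t \<in> borel_measurable M" unfolding t_def by measurable
    have "(\<integral>\<^sup>+ x. ennreal (exp (t x)) \<partial>N) = (\<integral>\<^sup>+ x. ennreal (d x) * ennreal (exp (t x)) \<partial>M)"
      unfolding N_d by (rule nn_integral_density) auto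
    also have "\<dots> \<le> (\<integral>\<^sup>+ x. exp_ereal (ereal k * (ereal (r x / c) - X x)) * ennreal (1 / w) \<partial>M)"
    proof (rule nn_integral_mono_AE)
      have "AE x in M. 0 < ennreal (d x) \<longrightarrow> X x = ereal (y x)"
        using X_y unfolding N_d by (subst (asm) AE_density) auto
      then show "AE x in M. ennreal (d x) * ennreal (exp (t x))
          \<le> exp_ereal (ereal k * (ereal (r x / c) - X x)) * ennreal (1 / w)"
      proof eventually_elim
        case (elim x)
        show ?case
        proof (cases "d x = 0")
          case False
          then have "0 < d x" using d_nonneg[of x] by simp
          then have "d x * exp (t x) = exp (k * (r x / c - y x)) * (1 / w)"
            using w unfolding t_def by (simp add: exp_diff)
          then have "ennreal (d x) * ennreal (exp (t x)) = ennreal (exp (k * (r x / c - y x))) * ennreal (1 / w)"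
            using w d_nonneg[of x] by (simp add: ennreal_mult[symmetric])
          then show ?thesis using elim \<open>0 < d x\<close> by simp
        qed simp
      qed
    qed
    also have "\<dots> = ennreal w * ennreal (1 / w)"
      using w by (subst nn_integral_multc) auto
    also have "\<dots> = 1" using w(2) by (simp add: ennreal_mult[symmetric])
    finally have exp_t: "(\<integral>\<^sup>+ x. ennreal (exp (t x)) \<partial>N) \<le> 1" .
    have int_exp: "integrable N (\<lambda>x. exp (t x))"
      by (rule integrableI_nonneg) (use exp_t in \<open>auto simp: less_top[symmetric] top_unique\<close>)
    have int_exp1: "(\<integral>x. exp (t x) \<partial>N) \<le> 1"
      using exp_t by (intro integral_real_bounded) auto
    \<comment> \<open>Replacing \<open>t\<close> by the larger \<open>exp t - 1\<close> gives an
      integrable lower bound of \<open>k * y\<close>. It controls the negative part of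
      \<open>y\<close>; integrating it then yields the inequality.\<close>
    define h where "h x = k * (r x / c) - ln w - ln (d x) - (exp (t x) - 1)" for x
    have int_h: "integrable N h"
      unfolding h_def using r int_ln int_exp by simp
    have h_le: "h x \<le> k * y x" for x
      using exp_ge_add_one_self[of "t x"] unfolding h_def t_def by (simp add: algebra_simps)
    have "(\<integral>\<^sup>+ x. ennreal (y x) \<partial>N) = (\<integral>\<^sup>+ x. e2ennreal (X x) \<partial>N)"
      by (rule nn_integral_cong_AE) (use X_y in \<open>auto elim!: eventually_mono\<close>)
    then have y_pos: "(\<integral>\<^sup>+ x. ennreal (y x) \<partial>N) \<noteq> \<infinity>" using X_pos by simp
    have "(\<integral>\<^sup>+ x. ennreal (- y x) \<partial>N) \<le> (\<integral>\<^sup>+ x. ennreal (- (h x / k)) \<partial>N)"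
      using h_le assms(5) by (intro nn_integral_mono ennreal_leI) (simp add: field_simps)
    also have "\<dots> < \<infinity>"
    proof -
      have "integrable N (\<lambda>x. h x / k)" using int_h by simp
      then show ?thesis by (simp add: real_integrable_def less_top)
    qed
    finally have int_y: "integrable N y"
      using y_pos by (simp add: real_integrable_def less_top)
    have "expect N X = expect N (\<lambda>x. ereal (y x))" by (rule expect_cong_AE[OF X_y])
    then have EX: "expect N X = ereal (\<integral>x. y x \<partial>N)"
      using expect_eq_integral[OF int_y] by simp
    have K: "kl N M = ereal (\<integral>x. ln (d x) \<partial>N)"
      unfolding kl by (rule expect_eq_integral[OF int_ln])
    have "(\<integral>x. h x \<partial>N) \<le> (\<integral>x. k * y x \<partial>N)"
      by (rule integral_mono) (use int_h int_y h_le in auto)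
    moreover have "(\<integral>x. h x \<partial>N)
      = k * ((\<integral>x. r x \<partial>N) / c) - ln w - (\<integral>x. ln (d x) \<partial>N) - ((\<integral>x. exp (t x) \<partial>N) - 1)"
      unfolding h_def using r int_ln int_exp by (simp add: N.prob_space[unfolded sp])
    ultimately have "k * ((\<integral>x. r x \<partial>N) / c) - k * (\<integral>x. y x \<partial>N) - (\<integral>x. ln (d x) \<partial>N) \<le> ln w"
      using int_exp1 by simp
    then have "exp (k * ((\<integral>x. r x \<partial>N) / c) - k * (\<integral>x. y x \<partial>N) - (\<integral>x. ln (d x) \<partial>N)) \<le> w"
      using w(2) by (simp add: ln_ge_iff)
    moreover have "k / c * ((\<integral>x. r x \<partial>N) - c * ((\<integral>x. y x \<partial>N) + (\<integral>x. ln (d x) \<partial>N) / k))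
      = k * ((\<integral>x. r x \<partial>N) / c) - k * (\<integral>x. y x \<partial>N) - (\<integral>x. ln (d x) \<partial>N)"
      using assms(5,6) by (simp add: field_simps)
    ultimately show ?thesis
      unfolding EX K w(1) using assms(5) by (simp add: ennreal_leI)
  qed
qed

text \<open>Splits the exponential of a sample mean into one factor per observation. A single
  infinite \<open>l i\<close> makes both sides 0.\<close>

lemma exp_ereal_mean_eq_prod:
  fixes l :: "nat \<Rightarrow> ereal" and \<eta> x :: real
  assumes "1 \<le> n" "0 < \<eta>" "\<And>i. i < n \<Longrightarrow> l i \<noteq> -\<infinity>"
  shows "exp_ereal (ereal (\<eta> * real n) * (ereal x - (\<Sum>i<n. l i) / ereal (real n)))
    = ennreal (exp (\<eta> * x)) ^ n * (\<Prod>i<n. exp_ereal (- ereal \<eta> * l i))"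
proof (cases "\<exists>i<n. l i = \<infinity>")
  case True
  then obtain j where j: "j < n" "l j = \<infinity>" by blast
  then have "(\<Sum>i<n. l i) = \<infinity>" by (auto simp: sum_Pinfty)
  moreover have "(\<Prod>i<n. exp_ereal (- ereal \<eta> * l i)) = 0"
    using j assms(2) by (intro prod_zero) (auto intro!: bexI[of _ j])
  ultimately show ?thesis using assms by simp
next
  case False
  define y where "y i = real_of_ereal (l i)" for i
  have y: "l i = ereal (y i)" if "i < n" for i
    unfolding y_def using that assms(3) False by (cases "l i") auto
  have "(\<Sum>i<n. l i) = ereal (\<Sum>i<n. y i)" by (simp add: y)
  moreover have "(\<Prod>i<n. exp_ereal (- ereal \<eta> * l i)) = ennreal (\<Prod>i<n. exp (- (\<eta> * y i)))"
    by (simp add: y prod_ennreal)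
  moreover have "exp (\<eta> * real n * (x - (\<Sum>i<n. y i) / real n))
      = exp (\<eta> * x) ^ n * (\<Prod>i<n. exp (- (\<eta> * y i)))"
  proof -
    have "\<eta> * real n * (x - (\<Sum>i<n. y i) / real n) = real n * (\<eta> * x) + (\<Sum>i<n. - (\<eta> * y i))"
      using assms by (simp add: sum_negf sum_distrib_left[symmetric] field_simps)
    then show ?thesis by (simp add: exp_add exp_sum exp_of_nat_mult)
  qed
  ultimately show ?thesis
    using assms by (simp add: ennreal_mult prod_nonneg ennreal_power)
qed

section \<open>Measurability of the excess loss and finiteness of the optimal loss\<close>

context learning_problem
begin

lemma measurable_excess_loss:
  "(\<lambda>(f, z). excess_loss loss fstar f z) \<in> borel_measurable (F \<Otimes>\<^sub>M P)"
proof -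
  have [measurable]: "loss fstar \<in> borel_measurable P"
    using measurable_compose[OF measurable_Pair1'[OF fstar_in] loss_measurable] by simp
  have "(\<lambda>x. (case x of (f, z) \<Rightarrow> loss f z) - loss fstar (snd x)) \<in> borel_measurable (F \<Otimes>\<^sub>M P)"
    by (intro borel_measurable_ereal_diff loss_measurable) measurable
  then show ?thesis by (simp add: excess_loss_def case_prod_beta')
qed

lemma measurable_excess_loss_section:
  "f \<in> space F \<Longrightarrow> excess_loss loss fstar f \<in> borel_measurable P"
  using measurable_compose[OF measurable_Pair1' measurable_excess_loss] by simp

lemma measurable_expect_excess_loss:
  "(\<lambda>f. expect P (excess_loss loss fstar f)) \<in> borel_measurable F"
proof -
  note measurable_excess_loss[measurable]
  show ?thesis unfolding expect_def by measurable
qed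

text \<open>A sample point at which \<open>fstar\<close> has infinite loss is one at which a \<open>\<Pi>\<^sub>0\<close>-positive set of
  predictors has excess loss \<open>-\<infinity>\<close>; by the central condition and Fubini these points are null.\<close>

lemma AE_loss_fstar_finite:
  assumes "learning_algorithm P F loss A" "strong_central P F loss fstar b" "0 < b"
  shows "AE z in P. loss fstar z \<noteq> \<infinity>"
proof -
  have "prob_space (A [])" and sets_A[measurable_cong]: "sets (A []) = sets F"
    and pos: "\<And>z. z \<in> space P \<Longrightarrow> emeasure (A []) {f\<in>space F. loss f z < \<infinity>} > 0"
    using assms(1) by (auto simp: learning_algorithm_def)
  interpret A: prob_space "A []" by fact
  interpret pair_sigma_finite "A []" P ..
  have sp: "space (A []) = space F" using sets_A by (rule sets_eq_imp_space_eq)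
  note loss_measurable[measurable]
  have [measurable]: "loss fstar \<in> borel_measurable P"
    using measurable_compose[OF measurable_Pair1'[OF fstar_in] loss_measurable] by simp
  \<comment> \<open>Indicator of the pairs with excess loss \<open>-\<infinity>\<close>. For fixed
    \<open>f\<close> it vanishes almost surely; exchanging integrals gives one null set of
    \<open>z\<close> outside which its prior integral is 0.\<close>
  let ?I = "\<lambda>f z. if loss f z < \<infinity> \<and> loss fstar z = \<infinity> then 1 else (0::ennreal)"
  have meas: "case_prod ?I \<in> borel_measurable (A [] \<Otimes>\<^sub>M P)" by measurable
  have "(\<integral>\<^sup>+ z. \<integral>\<^sup>+ f. ?I f z \<partial>A [] \<partial>P) = (\<integral>\<^sup>+ f. \<integral>\<^sup>+ z. ?I f z \<partial>P \<partial>A [])"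
    using meas by (rule Fubini')
  also have "\<dots> = (\<integral>\<^sup>+ f. 0 \<partial>A [])"
  proof (rule nn_integral_cong)
    fix f assume "f \<in> space (A [])"
    then have f: "f \<in> space F" by (simp add: sp)
    note measurable_excess_loss_section[OF f, measurable]
    have "(\<integral>\<^sup>+ z. exp_ereal (- ereal b * excess_loss loss fstar f z) \<partial>P) \<le> 1"
      using assms(2) f by (auto simp: strong_central_def)
    then have "AE z in P. exp_ereal (- ereal b * excess_loss loss fstar f z) \<noteq> \<infinity>"
      by (intro nn_integral_noteq_infinite) (auto simp: top_unique)
    then have "AE z in P. ?I f z = 0"
      using AE_space
    proof eventually_elim
      case (elim z)
      then show ?case using loss_not_MInfty[OF f elim(2)] assms(3)
        by (cases "loss f z") (auto simp: excess_loss_def)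
    qed
    then show "(\<integral>\<^sup>+ z. ?I f z \<partial>P) = 0" by (subst nn_integral_cong_AE) auto
  qed
  finally have "(\<integral>\<^sup>+ z. \<integral>\<^sup>+ f. ?I f z \<partial>A [] \<partial>P) = 0" by simp
  then have "AE z in P. (\<integral>\<^sup>+ f. ?I f z \<partial>A []) = 0"
    by (subst (asm) nn_integral_0_iff_AE) auto
  then show ?thesis
    using AE_space
  proof eventually_elim
    case (elim z)
    show ?case
    proof
      assume inf: "loss fstar z = \<infinity>"
      have "(\<lambda>f. loss f z) \<in> borel_measurable (A [])"
        using elim(2) by measurable
      then have "{f \<in> space F. loss f z < \<infinity>} \<in> sets (A [])"
        unfolding sp[symmetric] by measurable
      then have "emeasure (A []) {f \<in> space F. loss f z < \<infinity>}
          = (\<integral>\<^sup>+ f. indicator {f \<in> space F. loss f z < \<infinity>} f \<partial>A [])"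
        by simp
      also have "\<dots> = (\<integral>\<^sup>+ f. ?I f z \<partial>A [])"
        by (rule nn_integral_cong) (simp add: inf sp indicator_def)
      finally show False using elim(1) pos[OF elim(2)] by simp
    qed
  qed
qed

section \<open>From a bound for one observation to the exponential inequality\<close>

text \<open>The prior average \<open>Y\<close> of the \<open>n\<close>-fold products dominates the
  exponential in the ESI almost surely and has integral at most 1. The posterior may depend
  non-measurably on the sample, but \<open>Y\<close> involves only the prior, so it is a measurable
  majorant for the upper integral.\<close>

lemma esi_information_complexity:
  fixes A :: "'z list \<Rightarrow> 'f measure" and r :: "'f \<Rightarrow> real"
  assumes alg: "learning_algorithm P F loss A"
    and central: "strong_central P F loss fstar b" "0 < b"
    and pos: "0 < \<eta>" "0 < C" "1 \<le> n"
    and r: "\<And>f. f \<in> space F \<Longrightarrow> expect P (excess_loss loss fstar f) = ereal (r f)"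
    and bounded: "\<And>f. f \<in> space F \<Longrightarrow> \<bar>r f\<bar> \<le> B"
    and annealed: "\<And>f. f \<in> space F \<Longrightarrow> ennreal (exp (\<eta> * ((r f - lam) / C)))
      * (\<integral>\<^sup>+ z. exp_ereal (- ereal \<eta> * excess_loss loss fstar f z) \<partial>P) \<le> 1"
  shows "esi (iid n P) (\<eta> * real n / C)
    (\<lambda>\<omega>. posterior_excess_risk P loss fstar A (sample n \<omega>))
    (\<lambda>\<omega>. ereal lam + ereal C * information_complexity loss fstar A \<eta> (sample n \<omega>))"
proof -
  define L where "L = excess_loss loss fstar"
  define g where "g f = ennreal (exp (\<eta> * ((r f - lam) / C)))" for f
  define Y where "Y \<omega> = (\<integral>\<^sup>+ f. g f ^ n * (\<Prod>i<n. exp_ereal (- ereal \<eta> * L f (\<omega> i))) \<partial>A [])" for \<omega>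
  have A: "prob_space (A zs)" "sets (A zs) = sets F" "\<exists>\<rho>\<in>borel_measurable (A []). A zs = density (A []) \<rho>"
    if "zs \<in> lists (space P)" for zs
    using alg that by (auto simp: learning_algorithm_def)
  interpret M: prob_space "A []" by (rule A) simp
  have sets_M[measurable_cong]: "sets (A []) = sets F" by (rule A) simp
  have sp: "space (A zs) = space F" if "zs \<in> lists (space P)" for zs
    using A(2)[OF that] by (rule sets_eq_imp_space_eq)
  interpret PP: product_prob_space "\<lambda>_::nat. P" "{..<n}" ..
  interpret pair_sigma_finite "A []" "iid n P" ..
  have L_meas[measurable]: "(\<lambda>(f, z). L f z) \<in> borel_measurable (F \<Otimes>\<^sub>M P)"
    unfolding L_def by (rule measurable_excess_loss)
  have L_sect: "L f \<in> borel_measurable P" if "f \<in> space F" for f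
    unfolding L_def by (rule measurable_excess_loss_section[OF that])
  have L_f: "(\<lambda>f. L f z) \<in> borel_measurable F" if "z \<in> space P" for z
    using that by measurable
  have "(\<lambda>f. real_of_ereal (expect P (excess_loss loss fstar f))) \<in> borel_measurable F"
    using measurable_expect_excess_loss by measurable
  then have r_meas[measurable]: "r \<in> borel_measurable F"
    by (rule measurable_cong[THEN iffD1, rotated]) (simp add: r)
  have g_meas[measurable]: "g \<in> borel_measurable F" unfolding g_def by measurable
  have L_comp: "(\<lambda>x. L (fst x) (snd x i)) \<in> borel_measurable (F \<Otimes>\<^sub>M iid n P)" if "i < n" for i
  proof -
    have [measurable]: "(\<lambda>x. snd x i) \<in> measurable (F \<Otimes>\<^sub>M iid n P) P"
      by (rule measurable_compose[OF measurable_snd measurable_component_singleton]) (use that in simp)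
    have "(\<lambda>x. (fst x, snd x i)) \<in> measurable (F \<Otimes>\<^sub>M iid n P) (F \<Otimes>\<^sub>M P)" by measurable
    from measurable_compose[OF this L_meas] show ?thesis by simp
  qed
  have [measurable]: "(\<lambda>(f, \<omega>). \<Prod>i<n. exp_ereal (- ereal \<eta> * L f (\<omega> i)))
      \<in> borel_measurable (F \<Otimes>\<^sub>M iid n P)"
    unfolding case_prod_beta'
    by (intro borel_measurable_prod_ennreal measurable_compose[OF _ measurable_exp_ereal]
        borel_measurable_ereal_times L_comp) auto
  have integrand: "(\<lambda>(f, \<omega>). g f ^ n * (\<Prod>i<n. exp_ereal (- ereal \<eta> * L f (\<omega> i))))
      \<in> borel_measurable (A [] \<Otimes>\<^sub>M iid n P)"
    by measurable
  have Y_meas: "Y \<in> borel_measurable (iid n P)"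
  proof -
    have "(\<lambda>(\<omega>, f). g f ^ n * (\<Prod>i<n. exp_ereal (- ereal \<eta> * L f (\<omega> i))))
        \<in> borel_measurable (iid n P \<Otimes>\<^sub>M A [])"
      using measurable_pair_swap[OF integrand] by (simp add: case_prod_beta')
    then show ?thesis unfolding Y_def by (rule M.borel_measurable_nn_integral)
  qed
  have "(\<integral>\<^sup>+ \<omega>. Y \<omega> \<partial>iid n P)
      = (\<integral>\<^sup>+ f. \<integral>\<^sup>+ \<omega>. g f ^ n * (\<Prod>i<n. exp_ereal (- ereal \<eta> * L f (\<omega> i))) \<partial>iid n P \<partial>A [])"
    unfolding Y_def by (rule Fubini'[OF integrand])
  also have "\<dots> \<le> (\<integral>\<^sup>+ f. 1 \<partial>A [])"
  proof (rule nn_integral_mono)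
    fix f assume "f \<in> space (A [])"
    then have f: "f \<in> space F" by (simp add: sp)
    note L_sect[OF f, measurable]
    let ?m = "\<integral>\<^sup>+ z. exp_ereal (- ereal \<eta> * L f z) \<partial>P"
    have "(\<integral>\<^sup>+ \<omega>. g f ^ n * (\<Prod>i<n. exp_ereal (- ereal \<eta> * L f (\<omega> i))) \<partial>iid n P)
        = g f ^ n * (\<integral>\<^sup>+ \<omega>. (\<Prod>i<n. exp_ereal (- ereal \<eta> * L f (\<omega> i))) \<partial>iid n P)"
      by (intro nn_integral_cmult) measurable
    also have "(\<integral>\<^sup>+ \<omega>. (\<Prod>i<n. exp_ereal (- ereal \<eta> * L f (\<omega> i))) \<partial>iid n P) = (\<Prod>i<n. ?m)"
      by (rule PP.product_nn_integral_prod) auto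
    also have "g f ^ n * (\<Prod>i<n. ?m) = (g f * ?m) ^ n" by (simp add: power_mult_distrib)
    also have "\<dots> \<le> 1"
      using annealed[OF f] by (intro power_le_one) (auto simp: g_def L_def)
    finally show "(\<integral>\<^sup>+ \<omega>. g f ^ n * (\<Prod>i<n. exp_ereal (- ereal \<eta> * L f (\<omega> i))) \<partial>iid n P) \<le> 1" .
  qed
  also have "\<dots> = 1" by (simp add: M.emeasure_space_1)
  finally have Y_le: "(\<integral>\<^sup>+ \<omega>. Y \<omega> \<partial>iid n P) \<le> 1" .
  \<comment> \<open>This excludes excess loss \<open>-\<infinity>\<close> at the observations for
    all \<open>f\<close> at once: the exceptional set does not depend on \<open>f\<close>.\<close>
  have "AE \<omega> in iid n P. \<forall>i\<in>{..<n}. loss fstar (\<omega> i) \<noteq> \<infinity>"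
    by (intro AE_finite_allI AE_PiM_component AE_loss_fstar_finite[OF alg central])
      (auto intro: prob_space_axioms)
  then have "AE \<omega> in iid n P. exp_ereal (ereal (\<eta> * real n / C)
      * (posterior_excess_risk P loss fstar A (sample n \<omega>)
        - (ereal lam + ereal C * information_complexity loss fstar A \<eta> (sample n \<omega>)))) \<le> Y \<omega>"
    using AE_space
  proof eventually_elim
    case (elim \<omega>)
    have \<omega>: "\<omega> i \<in> space P" if "i < n" for i
      using elim(2) that by (auto simp: space_PiM PiE_def Pi_def)
    let ?N = "A (sample n \<omega>)"
    have zs: "sample n \<omega> \<in> lists (space P)" using \<omega> by auto
    interpret N: prob_space ?N by (rule A(1)[OF zs])
    note A(2)[OF zs, measurable_cong]
    obtain \<rho> where \<rho>: "\<rho> \<in> borel_measurable (A [])" "?N = density (A []) \<rho>"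
      using A(3)[OF zs] by blast
    define X where "X f = (\<Sum>i<n. L f (\<omega> i)) / ereal (real n)" for f
    have L_not: "L f (\<omega> i) \<noteq> -\<infinity>" if "f \<in> space F" "i < n" for f i
      using elim(1) that loss_not_MInfty[OF that(1) \<omega>[OF that(2)]]
      by (cases "loss f (\<omega> i)"; cases "loss fstar (\<omega> i)") (auto simp: L_def excess_loss_def)
    \<comment> \<open>The uniform bound \<open>B\<close> makes the excess risk integrable under
      every posterior.\<close>
    have int_r: "integrable ?N (\<lambda>f. r f - lam)"
      using bounded by (intro N.integrable_const_bound[of _ "B + \<bar>lam\<bar>"] AE_I2)
        (force simp: sp[OF zs])+
    have int_r': "integrable ?N r"
      using bounded by (intro N.integrable_const_bound[of _ B] AE_I2) (auto simp: sp[OF zs])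
    have "posterior_excess_risk P loss fstar A (sample n \<omega>) = expect ?N (\<lambda>f. ereal (r f))"
      unfolding posterior_excess_risk_def
      by (intro expect_cong_AE AE_I2) (simp add: sp[OF zs] r)
    also have "\<dots> = ereal (\<integral>f. r f \<partial>?N)" by (rule expect_eq_integral[OF int_r'])
    finally have U: "posterior_excess_risk P loss fstar A (sample n \<omega>) = ereal (\<integral>f. r f \<partial>?N)" .
    have V: "information_complexity loss fstar A \<eta> (sample n \<omega>)
        = expect ?N X + kl ?N (A []) / ereal (\<eta> * real n)"
      unfolding information_complexity_def X_def L_def by simp
    \<comment> \<open>Moves \<open>lam\<close> into the posterior integral, also for infinite
      complexity \<open>v\<close>.\<close>
    have shift: "ereal u - (ereal lam + v) = ereal (u - lam) - v" for u v
      by (cases v) auto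
    have "exp_ereal (ereal (\<eta> * real n / C)
      * (posterior_excess_risk P loss fstar A (sample n \<omega>)
        - (ereal lam + ereal C * information_complexity loss fstar A \<eta> (sample n \<omega>))))
      = exp_ereal (ereal (\<eta> * real n / C)
      * (ereal (\<integral>f. (r f - lam) \<partial>?N) - ereal C * (expect ?N X + kl ?N (A []) / ereal (\<eta> * real n))))"
      unfolding U V shift using int_r' by (simp add: N.prob_space)
    \<comment> \<open>Donsker-Varadhan with \<open>k = \<eta> * real n\<close> and
      \<open>c = C\<close> matches both the ESI rate \<open>k / C\<close> and the scaling of the
      divergence.\<close>
    also have "\<dots> \<le> (\<integral>\<^sup>+ f. exp_ereal (ereal (\<eta> * real n) * (ereal ((r f - lam) / C) - X f)) \<partial>A [])"
    proof (rule donsker_varadhan[OF M.prob_space_axioms N.prob_space_axioms \<rho>(2,1)])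
      show "X \<in> borel_measurable (A [])"
        unfolding X_def using L_f \<omega>
        by (intro borel_measurable_ereal_divide borel_measurable_ereal_sum) auto
      fix f assume "f \<in> space (A [])"
      then have f: "f \<in> space F" by (simp add: sp)
      have "(\<Sum>i<n. L f (\<omega> i)) \<noteq> -\<infinity>"
        using L_not[OF f] by (intro sum_ereal_not_MInfty) auto
      then show "X f \<noteq> -\<infinity>"
        unfolding X_def using pos by (cases "\<Sum>i<n. L f (\<omega> i)") auto
    qed (use pos int_r in auto)
    also have "\<dots> = Y \<omega>"
      unfolding Y_def X_def g_def
      using pos L_not by (intro nn_integral_cong exp_ereal_mean_eq_prod) (auto simp: sp)
    finally show ?case .
  qed
  from upper_nn_integral_le_AE[OF Y_meas this] Y_le
  show ?thesis unfolding esi_def by (rule order_trans)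
qed

text \<open>Part (i) of the theorem is the case \<open>lam = 0\<close>.\<close>

lemma annealed_bound:
  assumes central: "strong_central P F loss fstar b"
    and \<eta>: "0 < \<eta>" "\<eta> < b" and pos: "0 < u" "0 < c" "0 \<le> lam"
    and f: "f \<in> space F"
  defines "L \<equiv> excess_loss loss fstar f" and "C \<equiv> c_witness b \<eta> c u"
  assumes trunc: "expect P L < ereal lam
      \<or> ereal c * expect P L \<le> expect P (\<lambda>z. L z * indicator {z. L z \<le> ereal u} z)"
  obtains \<rho> where "expect P L = ereal \<rho>" "\<bar>\<rho>\<bar> \<le> lam + C / \<eta>"
    "ennreal (exp (\<eta> * ((\<rho> - lam) / C))) * (\<integral>\<^sup>+ z. exp_ereal (- ereal \<eta> * L z) \<partial>P) \<le> 1"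
proof -
  define K where "K = (\<eta> * u + 1) / (1 - \<eta> / b)"
  have K: "0 < K" unfolding K_def using \<eta> pos by (intro divide_pos_pos) (auto intro: add_pos_pos)
  have C_eq: "C = K / c" unfolding C_def K_def c_witness_def by simp
  have C: "0 < C" unfolding C_eq using K pos by simp
  let ?m = "\<integral>\<^sup>+ z. exp_ereal (- ereal \<eta> * L z) \<partial>P"
  have [measurable]: "L \<in> borel_measurable P"
    unfolding L_def by (rule measurable_excess_loss_section[OF f])
  have "(\<integral>\<^sup>+ z. exp_ereal (- ereal b * L z) \<partial>P) \<le> 1"
    using central f by (auto simp: strong_central_def L_def)
  note bound = truncated_expect_le_hellinger[of L \<eta> b u, OF _ \<eta> _ this]
  have m1: "?m \<le> 1" using bound(1) pos by simp
  define m where "m = enn2real ?m"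
  have "?m < top" by (rule le_less_trans[OF m1]) simp
  then have m_eq: "?m = ennreal m" by (simp only: m_def ennreal_enn2real)
  have m0: "0 \<le> m" unfolding m_def by simp
  have le: "expect P (\<lambda>z. L z * indicator {z. L z \<le> ereal u} z) \<le> ereal (K * ((1 - m) / \<eta>))"
    using bound(2) pos unfolding K_def m_def by simp
  have R0: "0 \<le> expect P L" unfolding L_def by (rule fstar_optimal[OF f])
  \<comment> \<open>Infinite risk contradicts both alternatives of \<open>trunc\<close>, since
    \<open>le\<close> bounds the truncated mean by a finite number.\<close>
  have "expect P L \<noteq> \<infinity>" using trunc le pos by auto
  then obtain \<rho> where \<rho>: "expect P L = ereal \<rho>" "0 \<le> \<rho>"
    using R0 by (cases "expect P L") auto
  \<comment> \<open>Below \<open>lam\<close> the left side is negative while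
    \<open>m \<le> 1\<close>; otherwise the truncation alternative must hold and combines with
    \<open>le\<close>.\<close>
  have y: "\<eta> * ((\<rho> - lam) / C) \<le> 1 - m"
  proof (cases "\<rho> < lam")
    case True
    then have "\<eta> * ((\<rho> - lam) / C) \<le> 0"
      using \<eta> C by (intro mult_nonneg_nonpos divide_nonpos_pos) auto
    moreover have "m \<le> 1" using m1 unfolding m_eq by simp
    ultimately show ?thesis by simp
  next
    case False
    then have "ereal (c * \<rho>) \<le> expect P (\<lambda>z. L z * indicator {z. L z \<le> ereal u} z)"
      using trunc \<rho>(1) by simp
    also note le
    finally have "c * \<rho> \<le> K * ((1 - m) / \<eta>)" by simp
    then have "\<eta> * (\<rho> / C) \<le> 1 - m"
      unfolding C_eq using \<eta> pos K by (simp add: field_simps)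
    moreover have "\<eta> * ((\<rho> - lam) / C) \<le> \<eta> * (\<rho> / C)"
      using \<eta> pos C by (intro mult_left_mono divide_right_mono) auto
    ultimately show ?thesis by simp
  qed
  show thesis
  proof (rule that[OF \<rho>(1)])
    \<comment> \<open>With \<open>m \<ge> 0\<close>, the same inequality bounds the risk uniformly
      in \<open>f\<close>.\<close>
    have "\<eta> * ((\<rho> - lam) / C) \<le> 1" using y m0 by simp
    then show "\<bar>\<rho>\<bar> \<le> lam + C / \<eta>" using \<rho>(2) \<eta> C by (simp add: field_simps)
    have "m \<le> exp (- (\<eta> * ((\<rho> - lam) / C)))"
      using y exp_ge_add_one_self[of "- (\<eta> * ((\<rho> - lam) / C))"] by simp
    then have "exp (\<eta> * ((\<rho> - lam) / C)) * m
        \<le> exp (\<eta> * ((\<rho> - lam) / C)) * exp (- (\<eta> * ((\<rho> - lam) / C)))"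
      by (intro mult_left_mono) auto
    also have "\<dots> = 1" by (simp add: exp_minus_inverse)
    finally show "ennreal (exp (\<eta> * ((\<rho> - lam) / C))) * ?m \<le> 1"
      unfolding m_eq using m0 by (simp add: ennreal_mult[symmetric])
  qed
qed

section \<open>Application to the two witness conditions\<close>

text \<open>Covers both witness conditions with one constant for all of \<open>F\<close>: predictors
  with risk below \<open>lam\<close> are absorbed by the additive \<open>lam\<close>, the others
  satisfy the truncation inequality at a common threshold \<open>u\<close>.\<close>

lemma esi_of_truncated_bound:
  assumes alg: "learning_algorithm P F loss A"
    and central: "strong_central P F loss fstar b"
    and \<eta>: "0 < \<eta>" "\<eta> < b" and pos: "0 < u" "0 < c" "0 \<le> lam" "1 \<le> n"
    and trunc: "\<And>f. f \<in> space F \<Longrightarrow> expect P (excess_loss loss fstar f) < ereal lam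
      \<or> ereal c * expect P (excess_loss loss fstar f) \<le> expect P (\<lambda>z. excess_loss loss fstar f z
          * indicator {z. excess_loss loss fstar f z \<le> ereal u} z)"
  shows "esi (iid n P) (\<eta> * real n / c_witness b \<eta> c u)
    (\<lambda>\<omega>. posterior_excess_risk P loss fstar A (sample n \<omega>))
    (\<lambda>\<omega>. ereal lam + ereal (c_witness b \<eta> c u) * information_complexity loss fstar A \<eta> (sample n \<omega>))"
proof -
  let ?C = "c_witness b \<eta> c u"
  have C: "0 < ?C"
    unfolding c_witness_def using \<eta> pos
    by (intro mult_pos_pos divide_pos_pos) (auto intro: add_pos_pos)
  have "\<exists>\<rho>. expect P (excess_loss loss fstar f) = ereal \<rho> \<and> \<bar>\<rho>\<bar> \<le> lam + ?C / \<eta>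
      \<and> ennreal (exp (\<eta> * ((\<rho> - lam) / ?C)))
        * (\<integral>\<^sup>+ z. exp_ereal (- ereal \<eta> * excess_loss loss fstar f z) \<partial>P) \<le> 1"
    if f: "f \<in> space F" for f
    by (rule annealed_bound[OF central \<eta> pos(1,2,3) f trunc[OF f]]) blast
  then obtain r where "\<forall>f\<in>space F. expect P (excess_loss loss fstar f) = ereal (r f)
      \<and> \<bar>r f\<bar> \<le> lam + ?C / \<eta> \<and> ennreal (exp (\<eta> * ((r f - lam) / ?C)))
        * (\<integral>\<^sup>+ z. exp_ereal (- ereal \<eta> * excess_loss loss fstar f z) \<partial>P) \<le> 1"
    by metis
  then show ?thesis
    using \<eta> by (intro esi_information_complexity[OF alg central _ \<eta>(1) C pos(4), where r = r]) auto
qed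

end

theorem theorem14:
  fixes P :: "'z measure" and F :: "'f measure"
    and loss :: "'f \<Rightarrow> 'z \<Rightarrow> ereal" and fstar :: 'f
    and A :: "'z list \<Rightarrow> 'f measure" and \<eta>bar :: real
  assumes "learning_problem P F loss fstar"
    and "learning_algorithm P F loss A"
    and "\<eta>bar > 0"
    and "strong_central P F loss fstar \<eta>bar"
  shows
    "(\<forall>u c. u > 0 \<and> 0 < c \<and> c \<le> 1 \<and> witness P F loss fstar u c \<longrightarrow>
        (\<forall>\<eta> n. 0 < \<eta> \<and> \<eta> < \<eta>bar \<and> n \<ge> 1 \<longrightarrow>
          (let cu = c_witness \<eta>bar \<eta> c u in
            esi (iid n P) (\<eta> * real n / cu)
              (\<lambda>\<omega>. posterior_excess_risk P loss fstar A (sample n \<omega>))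
              (\<lambda>\<omega>. ereal cu * information_complexity loss fstar A \<eta> (sample n \<omega>)))))
     \<and>
     (\<forall>\<tau> c. (\<forall>x\<ge>0. \<tau> x \<ge> 1) \<and> antimono_on {0..} \<tau> \<and> 0 < c \<and> c \<le> 1
          \<and> witness_fun P F loss fstar \<tau> c \<longrightarrow>
        (\<forall>\<eta> lam n. 0 < \<eta> \<and> \<eta> < \<eta>bar \<and> lam > 0 \<and> n \<ge> 1 \<longrightarrow>
          (let cu = c_witness \<eta>bar \<eta> c (\<tau> lam) in
            esi (iid n P) (\<eta> * real n / cu)
              (\<lambda>\<omega>. posterior_excess_risk P loss fstar A (sample n \<omega>))
              (\<lambda>\<omega>. ereal lam + ereal cu * information_complexity loss fstar A \<eta> (sample n \<omega>)))))"
proof (intro conjI allI impI; elim conjE)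
  interpret learning_problem P F loss fstar by fact
  fix u c \<eta> :: real and n :: nat
  assume *: "u > 0" "0 < c" "witness P F loss fstar u c" "0 < \<eta>" "\<eta> < \<eta>bar" "n \<ge> 1"
  have "ereal c * expect P (excess_loss loss fstar f) \<le> expect P (\<lambda>z. excess_loss loss fstar f z
          * indicator {z. excess_loss loss fstar f z \<le> ereal u} z)" if "f \<in> space F" for f
    using *(3) that by (simp add: witness_def Let_def)
  then show "let cu = c_witness \<eta>bar \<eta> c u in
            esi (iid n P) (\<eta> * real n / cu)
              (\<lambda>\<omega>. posterior_excess_risk P loss fstar A (sample n \<omega>))
              (\<lambda>\<omega>. ereal cu * information_complexity loss fstar A \<eta> (sample n \<omega>))"
    \<comment> \<open>\<open>order_refl\<close> instantiates \<open>lam\<close> to 0.\<close>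
    using esi_of_truncated_bound[OF assms(2,4) *(4,5,1,2) order_refl *(6)]
    by (simp add: Let_def)
next
  interpret learning_problem P F loss fstar by fact
  fix \<tau> :: "real \<Rightarrow> real" and c \<eta> lam :: real and n :: nat
  assume \<tau>: "\<forall>x\<ge>0. \<tau> x \<ge> 1" "antimono_on {0..} \<tau>"
    and *: "0 < c" "witness_fun P F loss fstar \<tau> c" "0 < \<eta>" "\<eta> < \<eta>bar" "lam > 0" "n \<ge> 1"
  have \<tau>_pos: "0 < \<tau> lam" using \<tau>(1) *(5) by (meson less_eq_real_def less_le_trans zero_less_one)
  have trunc: "expect P (excess_loss loss fstar f) < ereal lam
      \<or> ereal c * expect P (excess_loss loss fstar f) \<le> expect P (\<lambda>z. excess_loss loss fstar f z
          * indicator {z. excess_loss loss fstar f z \<le> ereal (\<tau> lam)} z)" if f: "f \<in> space F" for f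
  proof (cases "expect P (excess_loss loss fstar f) < ereal lam")
    case False
    let ?L = "excess_loss loss fstar f"
    obtain \<rho> where \<rho>: "expect P ?L = ereal \<rho>"
      using *(2) f fstar_optimal[OF f] by (cases "expect P ?L") (auto simp: witness_fun_def Let_def)
    then have "lam \<le> \<rho>" using False by simp
    \<comment> \<open>Once the risk is at least \<open>lam\<close>, monotonicity replaces its own
      threshold by the common one \<open>\<tau> lam\<close>.\<close>
    then have \<tau>_le: "1 \<le> \<tau> \<rho>" "\<tau> \<rho> \<le> \<tau> lam"
      using \<tau> *(5) by (auto simp: monotone_on_def)
    have "ereal c * expect P ?L \<le> expect P (\<lambda>z. ?L z * indicator {z. ?L z \<le> ereal (\<tau> \<rho>)} z)"
      using *(2) f \<rho> by (auto simp: witness_fun_def Let_def)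
    \<comment> \<open>Raising the threshold only admits losses above
      \<open>\<tau> \<rho> \<ge> 1\<close>, which are positive.\<close>
    also have "\<dots> \<le> expect P (\<lambda>z. ?L z * indicator {z. ?L z \<le> ereal (\<tau> lam)} z)"
    proof (intro expect_mono_AE AE_I2)
      fix z
      show "?L z * indicator {z. ?L z \<le> ereal (\<tau> \<rho>)} z \<le> ?L z * indicator {z. ?L z \<le> ereal (\<tau> lam)} z"
        using \<tau>_le by (cases "?L z") (auto simp: indicator_def zero_ereal_def)
    qed
    finally show ?thesis by simp
  qed simp
  show "let cu = c_witness \<eta>bar \<eta> c (\<tau> lam) in
            esi (iid n P) (\<eta> * real n / cu)
              (\<lambda>\<omega>. posterior_excess_risk P loss fstar A (sample n \<omega>))
              (\<lambda>\<omega>. ereal lam + ereal cu * information_complexity loss fstar A \<eta> (sample n \<omega>))"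
    using esi_of_truncated_bound[OF assms(2,4) *(3,4) \<tau>_pos *(1) less_imp_le[OF *(5)] *(6) trunc]
    by (simp add: Let_def)
qed

end
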